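(* Let $\ell, m\geq 2$ be integers with $\max\{\ell, m\}\geq 3$. Moreover, let $a, b\geq 1$ be odd integers with $s(a)=\ell$ and $s(b)=m$. If $s(ab)=3$, then $$ab<2^{-13+4\ell m}.$$
   Context: For a positive integer $n$, $s(n)$ denotes the number of nonzero digits in the binary expansion of $n$ (e.g. $s(23)=s((10111)_2)=4$). *)

theory Defs
  imports Main
begin

text \<open>The number of nonzero binary digits of \<open>n\<close>: for \<open>n :: nat\<close>, \<^term>\<open>bit n i\<close> says that the
  digit of \<open>n\<close> at the place of \<open>2 ^ i\<close> is 1, so the set below is finite.\<close>

definition s :: "nat \<Rightarrow> nat"
  where "s n = card {i. bit n i}"

end

theory Submission
  imports Defs "HOL-Computational_Algebra.Primes"
begin

text \<open>
  Write \<open>A\<close> and \<open>B\<close> for the sets of positions of the ones in \<open>a\<close> and \<open>b\<close>. As \<open>a b\<close> is odd and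
  has three ones, \<open>a b = 1 + 2 ^ u + 2 ^ v\<close> with \<open>0 < u < v\<close>. Expanding the product gives
  \<open>l m\<close> powers \<open>2 ^ (x + y)\<close>, one for each pair in \<open>A \<times> B\<close>, and the claim is
  \<open>v + 14 \<le> 4 l m\<close>.

  Taking powers of two greedily from above, one can always select some that add up to exactly
  \<open>2 ^ v\<close> (\<open>subfamily_sum_power_of_two\<close>). Hence the pairs other than \<open>(0, 0)\<close> split into a group
  \<open>H\<close> with sum \<open>2 ^ v\<close> and a group \<open>L\<close> with sum \<open>2 ^ u\<close>, where \<open>|L| + |H| + 1 = l m\<close>. If \<open>k\<close>
  powers of two add up to \<open>2 ^ w\<close>, the exponents all exceed \<open>w - k\<close>
  (\<open>less_exponent_plus_card\<close>). So each nonzero exponent is close below \<open>u\<close> or close below \<open>v\<close>.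

  If these two ranges meet, every nonzero \<open>x \<in> A\<close> and \<open>y \<in> B\<close> is close to \<open>v\<close>, while
  \<open>x + y \<le> v\<close>; therefore \<open>v\<close> is at most about \<open>2 l m\<close>. Otherwise a pair lies in \<open>H\<close> exactly
  when \<open>x + y > u\<close>. If both sets have an element above \<open>u\<close>, the same doubling bounds \<open>v\<close> by
  \<open>2 |H|\<close>. So by symmetry let all of \<open>B\<close> be at most \<open>u\<close>. Some \<open>x \<in> A\<close> and \<open>y \<in> B\<close>, both at
  most \<open>u\<close>, must have \<open>x + y > u\<close>: if not, \<open>H\<close> would be a full product \<open>A'' \<times> B\<close> and the odd
  number \<open>b > 1\<close> would divide \<open>2 ^ v\<close> (\<open>high_pair_of_low_exponents\<close>). This pair shows that \<open>v\<close>
  is not much larger than \<open>2 u\<close>, and two cases remain.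

  Either some nonzero \<open>x\<close> and \<open>y\<close> have \<open>x + y \<le> u\<close>; both are close to \<open>u\<close>, so \<open>u < 2 |L|\<close> and
  \<open>v\<close> is at most about \<open>4 |L| + |H|\<close>. This is the case that produces the constant
  (\<open>bound_of_low_product\<close>). Or no such pair exists, and then \<open>L\<close> and \<open>H\<close> are known so explicitly
  that divisibility by powers of two gives \<open>v < 3 |H|\<close> (\<open>bound_without_low_product\<close>). This last
  case must exclude \<open>l = m = 2\<close>, because the squares \<open>(2 ^ i + 1)\<^sup>2\<close> with \<open>i \<ge> 2\<close> have three ones
  and are unbounded.
\<close>

section \<open>Finite families of powers of two\<close>

text \<open>
  A single term \<open>2 ^ w\<close> does the job if there is one. Otherwise all exponents are below \<open>w\<close>, and
  one can split off a part with sum \<open>2 ^ (w - 1)\<close> twice, since removing the first part leaves at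
  least \<open>2 ^ (w - 1)\<close>.
\<close>

lemma subfamily_sum_power_of_two:
  fixes e :: "'i \<Rightarrow> nat"
  assumes "finite P" and "\<And>p. p \<in> P \<Longrightarrow> e p \<le> w" and "2 ^ w \<le> (\<Sum>p\<in>P. (2::nat) ^ e p)"
  shows "\<exists>Q\<subseteq>P. (\<Sum>p\<in>Q. (2::nat) ^ e p) = 2 ^ w"
  using assms
proof (induction w arbitrary: P)
  case 0
  then have "P \<noteq> {}" by auto
  then obtain p where "p \<in> P" by blast
  with 0 show ?case by (intro exI[of _ "{p}"]) auto
next
  case (Suc w)
  show ?case
  proof (cases "\<exists>p\<in>P. e p = Suc w")
    case True
    then obtain p where "p \<in> P" "e p = Suc w" by blast
    then show ?thesis by (intro exI[of _ "{p}"]) auto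
  next
    case False
    then have le: "e p \<le> w" if "p \<in> P" for p
      using Suc.prems(2) that le_Suc_eq by blast
    have "2 ^ w \<le> (\<Sum>p\<in>P. (2::nat) ^ e p)" using Suc.prems(3) by simp
    then obtain Q where Q: "Q \<subseteq> P" "(\<Sum>p\<in>Q. (2::nat) ^ e p) = 2 ^ w"
      using Suc.IH[OF Suc.prems(1) le] by blast
    have "(\<Sum>p\<in>P. (2::nat) ^ e p) = (\<Sum>p\<in>P - Q. 2 ^ e p) + (\<Sum>p\<in>Q. 2 ^ e p)"
      using Q(1) Suc.prems(1) by (rule sum.subset_diff)
    then have "2 ^ w \<le> (\<Sum>p\<in>P - Q. (2::nat) ^ e p)" using Suc.prems(3) Q(2) by simp
    then obtain R where R: "R \<subseteq> P - Q" "(\<Sum>p\<in>R. (2::nat) ^ e p) = 2 ^ w"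
      using Suc.IH[of "P - Q"] Suc.prems(1) le by auto
    have "(\<Sum>p\<in>Q \<union> R. (2::nat) ^ e p) = (\<Sum>p\<in>Q. 2 ^ e p) + (\<Sum>p\<in>R. 2 ^ e p)"
      using Q(1) R(1) Suc.prems(1) by (intro sum.union_disjoint) (auto intro: finite_subset)
    then show ?thesis using Q R by (intro exI[of _ "Q \<union> R"]) auto
  qed
qed

lemma exponent_le_of_sum_less:
  fixes e :: "'i \<Rightarrow> nat"
  assumes "finite P" and "p \<in> P" and "(\<Sum>p\<in>P. (2::nat) ^ e p) < 2 ^ Suc w"
  shows "e p \<le> w"
proof -
  have "(2::nat) ^ e p \<le> (\<Sum>p\<in>P. (2::nat) ^ e p)"
    using assms(1,2) by (intro member_le_sum) auto
  then have "(2::nat) ^ e p < 2 ^ Suc w" using assms(3) by simp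
  then show ?thesis by (metis less_Suc_eq_le nat_power_less_imp_less zero_less_numeral)
qed

lemma singleton_of_maximal_exponent:
  fixes e :: "'i \<Rightarrow> nat"
  assumes "finite P" and "(\<Sum>p\<in>P. (2::nat) ^ e p) = 2 ^ w" and "p \<in> P" and "e p = w"
  shows "P = {p}"
proof -
  have "(2::nat) ^ w + (\<Sum>q\<in>P - {p}. 2 ^ e q) = 2 ^ w"
    using sum.remove[OF assms(1,3), of "\<lambda>q. (2::nat) ^ e q"] assms(2,4) by metis
  then have "(\<Sum>q\<in>P - {p}. (2::nat) ^ e q) = 0" by (rule add_0_iff[THEN iffD1, OF sym])
  moreover have "0 < (\<Sum>q\<in>P - {p}. (2::nat) ^ e q)" if "P - {p} \<noteq> {}"
    using assms(1) that by (intro sum_pos finite_Diff) simp_all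
  ultimately have "P - {p} = {}" by (metis less_irrefl)
  then show ?thesis using assms(3) by blast
qed

text \<open>
  Building \<open>2 ^ w\<close> out of the terms by repeatedly merging two equal powers, each merger raises an
  exponent by one, and there are fewer mergers than terms. In the induction, the family splits into
  two nonempty halves of sum \<open>2 ^ (w - 1)\<close>, and the half that contains \<open>p\<close> has fewer terms.
\<close>

lemma less_exponent_plus_card:
  fixes e :: "'i \<Rightarrow> nat"
  assumes "finite P" and "(\<Sum>p\<in>P. (2::nat) ^ e p) = 2 ^ w" and "p \<in> P"
  shows "w < e p + card P"
  using assms
proof (induction w arbitrary: P)
  case 0
  then show ?case by (metis add_gr_0 card_gt_0_iff empty_iff)
next
  case (Suc w)
  show ?case
  proof (cases "\<exists>q\<in>P. e q = Suc w")
    case True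
    then obtain q where "q \<in> P" "e q = Suc w" by blast
    then have "P = {q}" using Suc.prems singleton_of_maximal_exponent by metis
    then show ?thesis using Suc.prems(3) \<open>e q = Suc w\<close> by auto
  next
    case False
    have le: "e q \<le> w" if "q \<in> P" for q
    proof -
      have "e q \<le> Suc w"
        using exponent_le_of_sum_less[OF Suc.prems(1) that] Suc.prems(2) by auto
      then show ?thesis using False that le_Suc_eq by blast
    qed
    obtain Q where Q: "Q \<subseteq> P" "(\<Sum>p\<in>Q. (2::nat) ^ e p) = 2 ^ w"
      using subfamily_sum_power_of_two[of P e w] Suc.prems le by auto
    have fin: "finite Q" "finite (P - Q)" using Q(1) Suc.prems(1) finite_subset by auto
    have "(\<Sum>p\<in>P. (2::nat) ^ e p) = (\<Sum>p\<in>P - Q. 2 ^ e p) + (\<Sum>p\<in>Q. 2 ^ e p)"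
      using Q(1) Suc.prems(1) by (rule sum.subset_diff)
    then have rest: "(\<Sum>p\<in>P - Q. (2::nat) ^ e p) = 2 ^ w" using Suc.prems(2) Q(2) by simp
    have ne: "Q \<noteq> {}" "P - Q \<noteq> {}"
      using Q(2) rest by (metis power_not_zero sum.empty zero_neq_numeral)+
    have "Q \<union> (P - Q) = P" using Q(1) by blast
    then have "card P = card Q + card (P - Q)" using card_Un_disjoint[OF fin] by auto
    moreover have "card Q > 0" "card (P - Q) > 0" using fin ne by (meson card_gt_0_iff)+
    ultimately have card: "card Q < card P" "card (P - Q) < card P" by simp_all
    show ?thesis
    proof (cases "p \<in> Q")
      case True
      then show ?thesis using Suc.IH[OF fin(1) Q(2)] card(1) by simp
    next
      case False
      then have "p \<in> P - Q" using Suc.prems(3) by blast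
      then have "w < e p + card (P - Q)" by (rule Suc.IH[OF fin(2) rest])
      then show ?thesis using card(2) by simp
    qed
  qed
qed

lemma sum_power2_Times:
  fixes X Y :: "nat set"
  shows "(\<Sum>p\<in>X \<times> Y. (2::nat) ^ (fst p + snd p)) = (\<Sum>x\<in>X. 2 ^ x) * (\<Sum>y\<in>Y. 2 ^ y)"
  by (simp add: sum_product sum.cartesian_product power_add case_prod_beta)

lemma sum_power2_distinct_eq_power2:
  fixes S :: "nat set"
  assumes "finite S" and "(\<Sum>i\<in>S. (2::nat) ^ i) = 2 ^ j"
  shows "S = {j}"
proof -
  have "j \<in> S"
  proof (rule ccontr)
    assume "j \<notin> S"
    have "i < j" if "i \<in> S" for i
      using exponent_le_of_sum_less[of S i "\<lambda>i. i" j] assms that \<open>j \<notin> S\<close>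
      by (cases "i = j") simp_all
    then have "S \<subseteq> {0..<j}" by auto
    then have "(\<Sum>i\<in>S. (2::nat) ^ i) \<le> (\<Sum>i\<in>{0..<j}. 2 ^ i)" by (intro sum_mono2) auto
    also have "\<dots> < 2 ^ j" by (simp add: sum_power2)
    finally show False using assms(2) by simp
  qed
  then show ?thesis using singleton_of_maximal_exponent[of S "\<lambda>i. i" j j] assms by blast
qed

lemma dvd_sum_power2:
  fixes S :: "nat set"
  assumes "\<And>i. i \<in> S \<Longrightarrow> t \<le> i"
  shows "(2::nat) ^ t dvd (\<Sum>i\<in>S. 2 ^ i)"
  using assms by (intro dvd_sum le_imp_power_dvd) auto

section \<open>Grouping the partial products\<close>

text \<open>
  \<open>A\<close> and \<open>B\<close> are the positions of the ones in two odd factors; the pair \<open>(0, 0)\<close> accounts for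
  the summand \<open>1\<close> of the product \<open>1 + 2 ^ u + 2 ^ v\<close>, and \<open>L\<close> and \<open>H\<close> for the other two.
\<close>

locale grouped_product =
  fixes A B :: "nat set" and L H :: "(nat \<times> nat) set" and u v :: nat
  assumes finite_A: "finite A" and finite_B: "finite B"
    and zero_A: "0 \<in> A" and zero_B: "0 \<in> B"
    and groups: "L \<union> H = A \<times> B - {(0, 0)}" and disjoint: "L \<inter> H = {}"
    and sum_L: "(\<Sum>p\<in>L. (2::nat) ^ (fst p + snd p)) = 2 ^ u"
    and sum_H: "(\<Sum>p\<in>H. (2::nat) ^ (fst p + snd p)) = 2 ^ v"
begin

text \<open>The two factors play the same role, so the case distinction may assume that \<open>B\<close> is the low one.\<close>

lemma swap: "grouped_product B A (L\<inverse>) (H\<inverse>) u v"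
proof -
  have conv: "(\<Sum>p\<in>R\<inverse>. (2::nat) ^ (fst p + snd p)) = (\<Sum>p\<in>R. 2 ^ (fst p + snd p))"
    for R :: "(nat \<times> nat) set"
    by (rule sum.reindex_bij_witness[of _ prod.swap prod.swap]) (auto simp: add.commute)
  have "L\<inverse> \<union> H\<inverse> = (A \<times> B - {(0, 0)})\<inverse>" using groups by blast
  then have "L\<inverse> \<union> H\<inverse> = B \<times> A - {(0, 0)}" by auto
  moreover have "L\<inverse> \<inter> H\<inverse> = {}" using disjoint by blast
  ultimately show ?thesis
    using finite_A finite_B zero_A zero_B sum_L sum_H by unfold_locales (simp_all add: conv)
qed

lemma finite_L: "finite L" and finite_H: "finite H"
  using finite_A finite_B groups by (metis finite_Diff finite_SigmaI finite_Un)+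

lemma card_groups: "card L + card H + 1 = card A * card B"
proof -
  have "card (L \<union> H) = card L + card H"
    using finite_L finite_H disjoint by (rule card_Un_disjoint)
  moreover have "card (A \<times> B) = card (A \<times> B - {(0, 0)}) + 1"
    using finite_A finite_B zero_A zero_B
    by (metis SigmaI Suc_eq_plus1 card.remove finite_SigmaI)
  ultimately show ?thesis using groups by (simp add: card_cartesian_product)
qed

lemma L_exponent: "(x, y) \<in> L \<Longrightarrow> x + y \<le> u \<and> u < x + y + card L"
  using exponent_le_of_sum_less[of L "(x, y)" "\<lambda>p. fst p + snd p" u]
    less_exponent_plus_card[of L "\<lambda>p. fst p + snd p" u "(x, y)"] finite_L sum_L by auto

lemma H_exponent: "(x, y) \<in> H \<Longrightarrow> x + y \<le> v \<and> v < x + y + card H"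
  using exponent_le_of_sum_less[of H "(x, y)" "\<lambda>p. fst p + snd p" v]
    less_exponent_plus_card[of H "\<lambda>p. fst p + snd p" v "(x, y)"] finite_H sum_H by auto

lemma L_or_H: "x \<in> A \<Longrightarrow> y \<in> B \<Longrightarrow> 0 < x + y \<Longrightarrow> (x, y) \<in> L \<or> (x, y) \<in> H"
  using groups by auto

lemma card_L_pos: "0 < card L" and card_H_pos: "0 < card H"
  using sum_L sum_H finite_L finite_H by (auto simp: card_gt_0_iff)

lemma nonzero_exponents:
  assumes "2 \<le> card A" and "2 \<le> card B"
  obtains x y where "x \<in> A" "0 < x" "y \<in> B" "0 < y"
proof -
  have "A \<noteq> {0}" "B \<noteq> {0}" using assms by auto
  then have "\<exists>x\<in>A. 0 < x" "\<exists>y\<in>B. 0 < y" using zero_A zero_B by auto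
  then show ?thesis using that by blast
qed

text \<open>
  Under the last hypothesis the exponents of \<open>H\<close> may reach down to those of \<open>L\<close>, so all
  nonzero exponents lie in one window of length about \<open>|L| + |H|\<close> below \<open>v\<close>. A nonzero \<open>x\<close>, a
  nonzero \<open>y\<close> and their sum all lie in that window, which forces its length to be at least about \<open>v / 2\<close>.
\<close>

lemma bound_without_gap:
  assumes "2 \<le> card A" and "2 \<le> card B" and "u \<le> v" and "v < u + card H"
  shows "v + 6 \<le> 2 * (card A * card B)"
proof -
  obtain x y where xy: "x \<in> A" "0 < x" "y \<in> B" "0 < y"
    using assms nonzero_exponents by blast
  have ge: "v + 3 \<le> i + j + card A * card B" if "(i, j) \<in> L \<union> H" for i j
    using that L_exponent[of i j] H_exponent[of i j] card_groups card_L_pos card_H_pos assms(4) by auto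
  have "v + 3 \<le> x + card A * card B" "v + 3 \<le> y + card A * card B"
    using ge[of x 0] ge[of 0 y] L_or_H xy zero_A zero_B by auto
  moreover have "x + y \<le> v"
    using L_or_H[OF xy(1,3)] xy(2) L_exponent[of x y] H_exponent[of x y] assms(3) by auto
  ultimately show ?thesis by linarith
qed

text \<open>
  The exponents in \<open>H\<close> exceed \<open>v - |H|\<close>, and those in \<open>L\<close> are at most \<open>u\<close>. Under the hypothesis
  of a gap, the size of the exponent therefore decides to which group a pair belongs.
\<close>

lemma mem_H_iff:
  assumes "u + card H \<le> v"
  shows "(x, y) \<in> H \<longleftrightarrow> x \<in> A \<and> y \<in> B \<and> u < x + y"
proof
  assume "(x, y) \<in> H"
  moreover from this have "(x, y) \<in> A \<times> B" using groups by blast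
  ultimately show "x \<in> A \<and> y \<in> B \<and> u < x + y" using H_exponent[of x y] assms by simp
next
  assume "x \<in> A \<and> y \<in> B \<and> u < x + y"
  then show "(x, y) \<in> H" using L_or_H[of x y] L_exponent[of x y] by linarith
qed

lemma mem_L_iff:
  assumes "u + card H \<le> v"
  shows "(x, y) \<in> L \<longleftrightarrow> x \<in> A \<and> y \<in> B \<and> 0 < x + y \<and> x + y \<le> u"
proof
  assume "(x, y) \<in> L"
  moreover from this have "(x, y) \<in> A \<times> B - {(0, 0)}" using groups by blast
  ultimately show "x \<in> A \<and> y \<in> B \<and> 0 < x + y \<and> x + y \<le> u" using L_exponent[of x y] by auto
next
  assume *: "x \<in> A \<and> y \<in> B \<and> 0 < x + y \<and> x + y \<le> u"
  then have "(x, y) \<notin> H" using mem_H_iff[OF assms] by simp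
  then show "(x, y) \<in> L" using * L_or_H by blast
qed

lemma bound_both_high:
  assumes gap: "u + card H \<le> v" and "x \<in> A" "u < x" "y \<in> B" "u < y"
  shows "v + 2 \<le> 2 * card H"
proof -
  have "(x, 0) \<in> H" "(0, y) \<in> H" "(x, y) \<in> H"
    using assms zero_A zero_B by (auto simp: mem_H_iff)
  then show ?thesis using H_exponent[of x 0] H_exponent[of 0 y] H_exponent[of x y] by simp
qed

lemma odd_sum_B: "odd (\<Sum>y\<in>B. (2::nat) ^ y)"
proof -
  have "even (\<Sum>y\<in>B - {0}. (2::nat) ^ y)" using dvd_sum_power2[of "B - {0}" 1] by auto
  then show ?thesis by (simp add: sum.remove[OF finite_B zero_B])
qed

text \<open>
  Without such a pair, \<open>x + y > u\<close> would just mean \<open>x > u\<close>. Then \<open>H\<close> would be the product of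
  \<open>{x \<in> A. u < x}\<close> with all of \<open>B\<close>, and its sum \<open>2 ^ v\<close> a multiple of the odd number that \<open>B\<close>
  represents; this number is not \<open>1\<close>.
\<close>

lemma high_pair_of_low_exponents:
  assumes gap: "u + card H \<le> v" and B_low: "\<forall>y\<in>B. y \<le> u" and "2 \<le> card B"
  obtains x y where "x \<in> A" "x \<le> u" "y \<in> B" "u < x + y"
proof (rule ccontr)
  assume "\<not> thesis"
  then have "\<not> (\<exists>x\<in>A. \<exists>y\<in>B. x \<le> u \<and> u < x + y)" using that by blast
  then have "H = {x \<in> A. u < x} \<times> B" using mem_H_iff[OF gap] by fastforce
  then have "(\<Sum>x | x \<in> A \<and> u < x. 2 ^ x) * (\<Sum>y\<in>B. 2 ^ y) = (2::nat) ^ v"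
    using sum_H by (simp add: sum_power2_Times)
  then have "(\<Sum>y\<in>B. 2 ^ y) dvd (2::nat) ^ v" by (metis dvd_triv_right)
  moreover have "coprime (\<Sum>y\<in>B. 2 ^ y) ((2::nat) ^ v)" using odd_sum_B by simp
  ultimately have "(\<Sum>y\<in>B. (2::nat) ^ y) = 2 ^ 0"
    by (metis coprime_common_divisor_nat dvd_refl power_0)
  then have "B = {0}" using finite_B sum_power2_distinct_eq_power2 by blast
  then show False using \<open>2 \<le> card B\<close> by simp
qed

text \<open>
  The three pairs \<open>(x, 0)\<close>, \<open>(0, y)\<close> and \<open>(x, y)\<close> all belong to \<open>L\<close>, which gives
  \<open>u \<le> 2 |L| - 2\<close>. A pair \<open>(x', y')\<close> of \<open>H\<close> with components at most \<open>u\<close> then bounds \<open>v\<close>. To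
  reach the constant 14 one uses that the components are even less than \<open>u\<close>: a term \<open>2 ^ u\<close> in
  \<open>L\<close> would exhaust the sum of \<open>L\<close>. With \<open>k = |L|\<close> and \<open>h = |H|\<close> this yields
  \<open>v \<le> 2 (u - 1) + h - 1 \<le> 4 k + h - 7 \<le> 4 (k + h + 1) - 14\<close>, with equality in the last step
  for \<open>h = 1\<close>.
\<close>

lemma bound_of_low_product:
  assumes gap: "u + card H \<le> v" and B_low: "\<forall>y\<in>B. y \<le> u" and "2 \<le> card B"
    and xy: "x \<in> A" "0 < x" "y \<in> B" "0 < y" "x + y \<le> u"
  shows "v + 14 \<le> 4 * (card A * card B)"
proof -
  have in_L: "(x, 0) \<in> L" "(0, y) \<in> L" using xy zero_A zero_B by (auto simp: mem_L_iff[OF gap])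
  then have u_le: "u + 2 \<le> 2 * card L"
    using L_exponent[of x 0] L_exponent[of 0 y] xy(5) by simp
  obtain x' y' where xy': "x' \<in> A" "x' \<le> u" "y' \<in> B" "u < x' + y'"
    using high_pair_of_low_exponents[OF gap B_low \<open>2 \<le> card B\<close>] by blast
  have "p \<notin> L" if "fst p + snd p = u" for p
  proof
    assume "p \<in> L"
    then have "L = {p}"
      using singleton_of_maximal_exponent[OF finite_L sum_L] that by simp
    then show False using in_L xy by auto
  qed
  then have "(u, 0) \<notin> L" "(0, u) \<notin> L" by auto
  then have "x' \<noteq> u" "y' \<noteq> u"
    using xy xy' zero_A zero_B by (auto simp: mem_L_iff[OF gap])
  moreover have "(x', y') \<in> H" using xy' by (simp add: mem_H_iff[OF gap])
  ultimately have "v + 3 \<le> 2 * u + card H" using H_exponent[of x' y'] xy' B_low by force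
  then show ?thesis using u_le card_groups card_H_pos by linarith
qed

text \<open>
  Let \<open>\<alpha>\<close>, \<open>\<gamma>\<close> and \<open>\<beta>\<close> be the sums of \<open>2 ^ x\<close> over \<open>A'\<close> (nonzero elements of \<open>A\<close> up to \<open>u\<close>), over
  \<open>A''\<close> (elements of \<open>A\<close> above \<open>u\<close>) and over \<open>B' = B - {0}\<close>. As no product of an element of \<open>A'\<close>
  with one of \<open>B'\<close> falls into \<open>L\<close>, the groups are known and \<open>\<alpha> + \<beta> = 2 ^ u\<close>,
  \<open>\<alpha> \<beta> + \<gamma> (1 + \<beta>) = 2 ^ v\<close>. If \<open>\<gamma> = 0\<close>, then \<open>\<alpha>\<close> and \<open>\<beta>\<close> divide \<open>2 ^ v\<close>, so they are powers of
  two and both factors have two ones. Otherwise an element \<open>z\<close> of \<open>A''\<close> is already within \<open>|H|\<close>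
  of \<open>v\<close>, and \<open>z + y \<le> v\<close> makes each \<open>y \<in> B\<close> less than \<open>|H|\<close>. The least \<open>x \<in> A'\<close> is less
  than \<open>|H|\<close> as well, since \<open>2 ^ x\<close> divides \<open>\<alpha>\<close> and \<open>2 ^ u\<close> and hence \<open>\<beta> < 2 ^ |H|\<close>. Now
  \<open>(x, y) \<in> H\<close> for \<open>y \<in> B'\<close> bounds \<open>v\<close>.
\<close>

lemma bound_without_low_product:
  assumes gap: "u + card H \<le> v" and B_low: "\<forall>y\<in>B. y \<le> u"
    and "2 \<le> card A" "2 \<le> card B" and large: "3 \<le> card A \<or> 3 \<le> card B"
    and none: "\<And>x y. x \<in> A \<Longrightarrow> 0 < x \<Longrightarrow> y \<in> B \<Longrightarrow> 0 < y \<Longrightarrow> u < x + y"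
  shows "v + 3 \<le> 3 * card H"
proof -
  define A' where "A' = {x \<in> A. 0 < x \<and> x \<le> u}"
  define A'' where "A'' = {x \<in> A. u < x}"
  define B' where "B' = B - {0}"
  have fin: "finite A'" "finite A''" "finite B'"
    using finite_A finite_B by (auto simp: A'_def A''_def B'_def)
  have B'_ne: "B' \<noteq> {}" using \<open>2 \<le> card B\<close> by (auto simp: B'_def dest: subset_singletonD)
  have "\<exists>x\<in>A. \<exists>y\<in>B. x \<le> u \<and> u < x + y"
    using high_pair_of_low_exponents[OF gap B_low \<open>2 \<le> card B\<close>] by metis
  then have A'_ne: "A' \<noteq> {}" using B_low by (fastforce simp: A'_def)
  have L_eq: "L = A' \<times> {0} \<union> {0} \<times> B'"
    using none B_low zero_A zero_B
    by (fastforce simp: mem_L_iff[OF gap] A'_def B'_def)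
  have H_eq: "H = A' \<times> B' \<union> A'' \<times> B"
    using none B_low zero_A zero_B
    by (fastforce simp: mem_H_iff[OF gap] A'_def A''_def B'_def)
  have "(\<Sum>p\<in>L. (2::nat) ^ (fst p + snd p))
      = (\<Sum>p\<in>A' \<times> {0}. 2 ^ (fst p + snd p)) + (\<Sum>p\<in>{0} \<times> B'. 2 ^ (fst p + snd p))"
    unfolding L_eq using fin by (intro sum.union_disjoint) (auto simp: A'_def)
  then have low_sum: "(\<Sum>x\<in>A'. 2 ^ x) + (\<Sum>y\<in>B'. 2 ^ y) = (2::nat) ^ u"
    using sum_L by (simp add: sum_power2_Times)
  show ?thesis
  proof (cases "A'' = {}")
    case True
    then have "(\<Sum>x\<in>A'. 2 ^ x) * (\<Sum>y\<in>B'. 2 ^ y) = (2::nat) ^ v"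
      using sum_H by (simp add: H_eq sum_power2_Times)
    then have "(\<Sum>x\<in>A'. 2 ^ x) dvd (2::nat) ^ v" "(\<Sum>y\<in>B'. 2 ^ y) dvd (2::nat) ^ v"
      by (metis dvd_triv_left, metis dvd_triv_right)
    then obtain i j where "(\<Sum>x\<in>A'. (2::nat) ^ x) = 2 ^ i" "(\<Sum>y\<in>B'. (2::nat) ^ y) = 2 ^ j"
      using divides_primepow_nat[OF two_is_prime_nat] by metis
    then have "A' = {i}" "B' = {j}" using fin sum_power2_distinct_eq_power2 by blast+
    moreover have "A = insert 0 A'" using True zero_A by (auto simp: A'_def A''_def)
    moreover have "B = insert 0 B'" using zero_B by (auto simp: B'_def)
    ultimately have "card A \<le> 2" "card B \<le> 2" by (auto simp: card_insert_if)
    then show ?thesis using large by simp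
  next
    case False
    then obtain z where z: "z \<in> A" "u < z" by (auto simp: A''_def)
    have y_less: "y < card H" if "y \<in> B" for y
    proof -
      have "(z, 0) \<in> H" "(z, y) \<in> H" using z that zero_B by (auto simp: mem_H_iff[OF gap])
      then show ?thesis using H_exponent[of z 0] H_exponent[of z y] by simp
    qed
    have "(\<Sum>y\<in>B'. (2::nat) ^ y) \<le> (\<Sum>y\<in>{0..<card H}. 2 ^ y)"
      using y_less by (intro sum_mono2) (auto simp: B'_def)
    \<comment> \<open>distinct exponents below \<open>|H|\<close> contribute less than \<open>2 ^ |H|\<close>\<close>
    then have B'_less: "(\<Sum>y\<in>B'. (2::nat) ^ y) < 2 ^ card H"
      by (simp add: sum_power2 less_eq_iff_succ_less)
    define x where "x = Min A'"
    have x: "x \<in> A'" "\<And>i. i \<in> A' \<Longrightarrow> x \<le> i" using fin A'_ne by (auto simp: x_def)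
    have "(2::nat) ^ x dvd 2 ^ u" using x(1) by (auto simp: A'_def intro: le_imp_power_dvd)
    then have "(2::nat) ^ x dvd (\<Sum>y\<in>B'. 2 ^ y)"
      using dvd_sum_power2[of A' x] x(2) low_sum by (metis dvd_add_right_iff)
    moreover have "0 < (\<Sum>y\<in>B'. (2::nat) ^ y)" using fin B'_ne by (intro sum_pos) auto
    ultimately have "(2::nat) ^ x < 2 ^ card H" using B'_less by (meson dvd_imp_le le_less_trans)
    then have "x < card H" by (metis nat_power_less_imp_less zero_less_numeral)
    moreover obtain y where y: "y \<in> B'" using B'_ne by blast
    moreover have "(x, y) \<in> H" using x(1) y by (auto simp: H_eq)
    ultimately show ?thesis using y_less[of y] H_exponent[of x y] by (auto simp: B'_def)
  qed
qed

lemma bound_with_low_B: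
  assumes gap: "u + card H \<le> v" and B_low: "\<forall>y\<in>B. y \<le> u"
    and "2 \<le> card A" "2 \<le> card B" and large: "3 \<le> card A \<or> 3 \<le> card B"
  shows "v + 14 \<le> 4 * (card A * card B)"
proof (cases "\<exists>x\<in>A. \<exists>y\<in>B. 0 < x \<and> 0 < y \<and> x + y \<le> u")
  case True
  then show ?thesis using bound_of_low_product[OF gap B_low \<open>2 \<le> card B\<close>] by blast
next
  case False
  then have "v + 3 \<le> 3 * card H"
    using bound_without_low_product[OF assms] by (meson not_le)
  moreover have "2 * 3 \<le> card A * card B \<or> 3 * 2 \<le> card A * card B"
    using assms(3-5) mult_le_mono by blast
  ultimately show ?thesis using card_groups card_L_pos by linarith
qed

lemma top_exponent_bound:
  assumes "2 \<le> card A" "2 \<le> card B" and large: "3 \<le> card A \<or> 3 \<le> card B" and "u \<le> v"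
  shows "v + 14 \<le> 4 * (card A * card B)"
proof -
  interpret sw: grouped_product B A "L\<inverse>" "H\<inverse>" u v by (rule swap)
  have "2 * 2 \<le> card A * card B" using assms mult_le_mono by blast
  consider "v < u + card H" | "u + card H \<le> v" "\<forall>y\<in>B. y \<le> u"
    | "u + card H \<le> v" "\<forall>x\<in>A. x \<le> u"
    | x y where "u + card H \<le> v" "x \<in> A" "u < x" "y \<in> B" "u < y"
    by (meson not_le)
  then show ?thesis
  proof cases
    case 1
    then show ?thesis using bound_without_gap assms \<open>2 * 2 \<le> _\<close> by fastforce
  next
    case 2
    then show ?thesis using bound_with_low_B assms by blast
  next
    case 3
    then show ?thesis using sw.bound_with_low_B assms by (auto simp: mult.commute)
  next
    case 4
    then show ?thesis using bound_both_high card_groups card_L_pos \<open>2 * 2 \<le> _\<close> by fastforce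
  qed
qed

end

section \<open>Binary digits\<close>

lemma bit_imp_position_less: "bit (n::nat) i \<Longrightarrow> i < n"
  by (metis bit_iff_odd div_less even_zero leD leI less_exp less_le_trans)

lemma finite_bits: "finite {i. bit (n::nat) i}"
  by (rule finite_subset[of _ "{..<n}"]) (auto dest: bit_imp_position_less)

lemma sum_bits: "(\<Sum>i | bit n i. 2 ^ i) = (n::nat)"
proof -
  have "n = take_bit n n" by (simp add: take_bit_nat_eq_self)
  also have "\<dots> = (\<Sum>i = 0..<n. if bit n i then 2 ^ i else 0)"
    unfolding take_bit_sum by (intro sum.cong) (auto simp: push_bit_eq_mult)
  also have "\<dots> = (\<Sum>i | i \<in> {0..<n} \<and> bit n i. 2 ^ i)"
    by (rule sum.inter_filter[symmetric]) simp
  also have "{i. i \<in> {0..<n} \<and> bit n i} = {i. bit n i}" by (auto dest: bit_imp_position_less)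
  finally show ?thesis by simp
qed

lemma grouped_product_of_bits:
  fixes a b u v :: nat
  assumes "odd a" and "odd b" and prod: "a * b = 1 + 2 ^ u + 2 ^ v" and "u < v"
  obtains L H where "grouped_product {i. bit a i} {i. bit b i} L H u v"
proof -
  define P where "P = {i. bit a i} \<times> {i. bit b i} - {(0, 0)}"
  let ?e = "\<lambda>p::nat \<times> nat. fst p + snd p"
  have fin: "finite P" by (simp add: P_def finite_bits)
  have zero: "bit a 0" "bit b 0" using assms by (auto simp: bit_0)
  have "(\<Sum>p\<in>{i. bit a i} \<times> {i. bit b i}. (2::nat) ^ ?e p) = 1 + 2 ^ u + 2 ^ v"
    by (simp add: sum_power2_Times sum_bits prod)
  then have sum_P: "(\<Sum>p\<in>P. (2::nat) ^ ?e p) = 2 ^ u + 2 ^ v"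
    using zero finite_bits
      sum.remove[of "{i. bit a i} \<times> {i. bit b i}" "(0, 0)" "\<lambda>p. (2::nat) ^ ?e p"]
    by (simp add: P_def)
  have "(2::nat) ^ u < 2 ^ v" using \<open>u < v\<close> by simp
  then have "?e p \<le> v" if "p \<in> P" for p
    using exponent_le_of_sum_less[OF fin that, of ?e v] sum_P by auto
  then obtain H where H: "H \<subseteq> P" "(\<Sum>p\<in>H. (2::nat) ^ ?e p) = 2 ^ v"
    using subfamily_sum_power_of_two[OF fin, of ?e v] sum_P by auto
  have "(\<Sum>p\<in>P - H. (2::nat) ^ ?e p) = 2 ^ u"
    using sum.subset_diff[OF H(1) fin, of "\<lambda>p. (2::nat) ^ ?e p"] sum_P H(2) by simp
  then have "grouped_product {i. bit a i} {i. bit b i} (P - H) H u v"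
    using H zero finite_bits by unfold_locales (auto simp: P_def)
  then show ?thesis using that by blast
qed

theorem theorem2p2:
  fixes l m a b :: nat
  assumes "l \<ge> 2" and "m \<ge> 2" and "max l m \<ge> 3"
    and "a \<ge> 1" and "b \<ge> 1" and "odd a" and "odd b"
    and "s a = l" and "s b = m"
    and "s (a * b) = 3"
  shows "a * b < 2 ^ (4 * l * m - 13)"
proof -
  let ?D = "{i. bit (a * b) i}"
  have "0 \<in> ?D" using assms(6,7) by (simp add: bit_0)
  moreover have "card ?D = 3" using assms(10) by (simp add: s_def)
  ultimately have "card (?D - {0}) = 2" by simp
  then obtain p q where pq: "?D - {0} = {p, q}" "p \<noteq> q" by (meson card_2_iff)
  obtain u v where uv: "?D - {0} = {u, v}" "u < v"
  proof (cases "p < q")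
    case True
    then show ?thesis using that pq(1) by blast
  next
    case False
    then have "q < p" using pq(2) by simp
    moreover have "?D - {0} = {q, p}" using pq(1) by blast
    ultimately show ?thesis using that by blast
  qed
  have D: "?D = {0, u, v}" using uv(1) \<open>0 \<in> ?D\<close> by blast
  have "u \<in> ?D - {0}" unfolding uv(1) by (rule insertI1)
  then have "u \<notin> {0}" unfolding Diff_iff by (rule conjunct2)
  then have u_pos: "0 < u" by simp
  have "(\<Sum>i\<in>{0, u, v}. 2 ^ i) = a * b" using sum_bits[of "a * b"] unfolding D .
  then have prod: "a * b = 1 + 2 ^ u + 2 ^ v" using uv(2) u_pos by simp
  obtain L H where "grouped_product {i. bit a i} {i. bit b i} L H u v"
    using grouped_product_of_bits[OF assms(6,7) prod uv(2)] .
  then interpret grouped_product "{i. bit a i}" "{i. bit b i}" L H u v .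
  have "v + 14 \<le> 4 * (l * m)"
    using top_exponent_bound assms(1-3,8,9) uv(2) by (auto simp: s_def max_def split: if_splits)
  then have "Suc v \<le> 4 * l * m - 13" by simp
  have "(2::nat) ^ 1 \<le> 2 ^ u" using u_pos by (intro power_increasing) auto
  moreover have "(2::nat) ^ Suc u \<le> 2 ^ v" using uv(2) by (intro power_increasing) auto
  ultimately have "a * b < 2 ^ Suc v" using prod by simp
  also have "\<dots> \<le> 2 ^ (4 * l * m - 13)"
    using \<open>Suc v \<le> _\<close> by (intro power_increasing) auto
  finally show ?thesis .
qed

end
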